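(* Let $n\ge 1$ and let $f:\{-1,1\}^n\to\{-1,1\}$ be an $m$-sparse Boolean function with $1\le m\le 2^{n-1}$. Then $f$ has a polynomial threshold function representation with integer coefficients, of length at most $2^{n-1}+\min(m,2^{n-2})$, in which every coefficient has absolute value at most $2^{\,n+0.5\,m\log_2 m-m+1.5\log_2 m+2}$.
   Context: A Boolean function $f:\{-1,1\}^n\to\{-1,1\}$ is called $m$-sparse if $m=\min(|f^{-1}(1)|,|f^{-1}(-1)|)$ (the informal requirement that $m$ be small compared with $2^n$ is replaced by the explicit hypothesis on $m$ in the statement). A multilinear polynomial $p(x)=\sum_{S\subseteq\{1,\dots,n\}} w_S\prod_{k\in S}x_k$ is a polynomial threshold function (PTF) representation of $f$ if $f(x)=\operatorname{sgn}(p(x))$ for all $x\in\{-1,1\}^n$; in particular $p(x)\neq 0$ for all such $x$. Its length is the number of non-zero coefficients $w_S$. *)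

theory Defs
  imports Complex_Main "HOL-Library.FuncSet"
begin

text \<open>Points of the cube are functions on \<open>{1..n}\<close> that are \<open>undefined\<close> elsewhere, so each
  point is represented exactly once and cardinalities of subsets of the cube are the intended ones.\<close>

definition cube :: "nat \<Rightarrow> (nat \<Rightarrow> real) set" where
  "cube n = {1..n} \<rightarrow>\<^sub>E {-1, 1}"

definition boolean_function :: "nat \<Rightarrow> ((nat \<Rightarrow> real) \<Rightarrow> real) \<Rightarrow> bool" where
  "boolean_function n f \<longleftrightarrow> (\<forall>x\<in>cube n. f x \<in> {-1, 1})"

definition sparse :: "nat \<Rightarrow> nat \<Rightarrow> ((nat \<Rightarrow> real) \<Rightarrow> real) \<Rightarrow> bool" where
  "sparse n m f \<longleftrightarrow> m = min (card {x \<in> cube n. f x = 1}) (card {x \<in> cube n. f x = -1})"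

text \<open>A multilinear polynomial in \<open>n\<close> variables is given by its coefficients \<open>w S\<close>
  for \<open>S \<subseteq> {1..n}\<close>; values of \<open>w\<close> at other sets are irrelevant.\<close>

definition multilinear_eval :: "nat \<Rightarrow> (nat set \<Rightarrow> real) \<Rightarrow> (nat \<Rightarrow> real) \<Rightarrow> real" where
  "multilinear_eval n w x = (\<Sum>S\<in>Pow {1..n}. w S * (\<Prod>k\<in>S. x k))"

text \<open>As \<open>sgn 0 = 0\<close>, representing a function with values in \<open>{-1, 1}\<close> forces the
  polynomial to be non-zero on the whole cube.\<close>

definition ptf_represents :: "nat \<Rightarrow> (nat set \<Rightarrow> real) \<Rightarrow> ((nat \<Rightarrow> real) \<Rightarrow> real) \<Rightarrow> bool" where
  "ptf_represents n w f \<longleftrightarrow> (\<forall>x\<in>cube n. f x = sgn (multilinear_eval n w x))"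

definition ptf_length :: "nat \<Rightarrow> (nat set \<Rightarrow> real) \<Rightarrow> nat" where
  "ptf_length n w = card {S. S \<subseteq> {1..n} \<and> w S \<noteq> 0}"

end

theory Submission
  imports Defs
begin

text \<open>Write \<open>p(y, v) = a(y) + v b(y)\<close>, where \<open>v\<close> is the last coordinate. At a point \<open>y\<close> where
  \<open>f(y, 1)\<close> and \<open>f(y, -1)\<close> differ, \<open>b\<close> must dominate \<open>a\<close> and determines the sign; elsewhere \<open>a\<close> must
  dominate \<open>b\<close>. There are at most \<open>m\<close> points of the first kind. Let \<open>D\<close>, of size \<open>k\<close>, be the smaller
  of the two sets of points, so \<open>k \<le> min m (2^(n-2))\<close>. The polynomial dominating on \<open>D\<close> is taken with
  only \<open>k\<close> monomials, interpolating the required signs on \<open>D\<close>; the other one vanishes on \<open>D\<close> and is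
  \<open>\<plusminus>2^k\<close> off \<open>D\<close>.

  Choosing the \<open>k\<close> monomials by recursion on the coordinates, instead of as an arbitrary basis of the
  functions on \<open>D\<close>, gives an interpolant that takes integer values of size less than \<open>2^k\<close> on the whole
  cube, without determinant estimates. Multiplication by \<open>2^(n-1)\<close> then makes all coefficients integers
  of size at most \<open>2^(n-1+k)\<close>, which is below the required bound since \<open>16^m \<le> 64 m^(m+3)\<close>.\<close>

section \<open>Splitting off the last coordinate\<close>

lemma cube_0: "cube 0 = {\<lambda>_. undefined}"
  by (simp add: cube_def)

lemma finite_cube: "finite (cube n)"
  by (simp add: cube_def finite_PiE)

lemma card_cube: "card (cube n) = 2 ^ n"
  by (simp add: cube_def card_PiE numeral_2_eq_2)

lemma atLeastAtMost_1_Suc: "{1..Suc n} = insert (Suc n) {1..n}"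
  by auto

lemma cube_upd: "y \<in> cube n \<Longrightarrow> v \<in> {-1, 1} \<Longrightarrow> y(Suc n := v) \<in> cube (Suc n)"
  unfolding cube_def atLeastAtMost_1_Suc PiE_insert_eq by (auto intro!: image_eqI[of _ _ "(v, y)"])

lemma cube_SucE:
  assumes "x \<in> cube (Suc n)"
  obtains y v where "y \<in> cube n" "v \<in> {-1, 1}" "x = y(Suc n := v)"
  using assms unfolding cube_def atLeastAtMost_1_Suc PiE_insert_eq by auto

lemma ball_cube_Suc:
  "(\<forall>x\<in>cube (Suc n). P x) \<longleftrightarrow> (\<forall>y\<in>cube n. P (y(Suc n := 1)) \<and> P (y(Suc n := -1)))"
  by (auto intro: cube_upd elim: cube_SucE)

lemma cube_upd_inj:
  assumes "y \<in> cube n" "z \<in> cube n" "y(Suc n := u) = z(Suc n := v)"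
  shows "y = z"
proof
  fix i
  \<comment> \<open>Only coordinate \<open>Suc n\<close> is overwritten, and there both points have
    the value \<open>undefined\<close>.\<close>
  have "y (Suc n) = z (Suc n)"
    using assms(1,2) by (simp add: cube_def PiE_def extensional_def)
  then show "y i = z i"
    using fun_cong[OF assms(3), of i] by (cases "i = Suc n") auto
qed

lemma multilinear_eval_0: "multilinear_eval 0 w x = w {}"
  by (simp add: multilinear_eval_def)

text \<open>Monomials without the last variable give the part \<open>a\<close>, those containing it
  give \<open>v\<close> times the part \<open>b\<close>. The same \<open>w\<close> serves as
  coefficients of \<open>a\<close>, since \<open>multilinear_eval n\<close> ignores sets containing
  \<open>Suc n\<close>. All later inductions on \<open>n\<close> rest on this splitting.\<close>

lemma multilinear_eval_Suc:
  "multilinear_eval (Suc n) w (y(Suc n := v)) =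
    multilinear_eval n w y + v * multilinear_eval n (\<lambda>S. w (insert (Suc n) S)) y"
proof -
  have inj: "inj_on (insert (Suc n)) (Pow {1..n})"
    by (rule inj_onI) (metis PowD Suc_n_not_le_n atLeastAtMost_iff insert_ident subset_iff)
  have old: "(\<Prod>k\<in>S. (y(Suc n := v)) k) = (\<Prod>k\<in>S. y k)" if "S \<in> Pow {1..n}" for S
    using that by (intro prod.cong) auto
  have new: "(\<Prod>k\<in>insert (Suc n) S. (y(Suc n := v)) k) = v * (\<Prod>k\<in>S. y k)"
    if "S \<in> Pow {1..n}" for S
  proof -
    have "finite S" "Suc n \<notin> S"
      using that finite_subset by auto
    then show ?thesis
      using old[OF that] by simp
  qed
  have "multilinear_eval (Suc n) w (y(Suc n := v)) =
    (\<Sum>S\<in>Pow {1..n}. w S * (\<Prod>k\<in>S. (y(Suc n := v)) k)) +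
    (\<Sum>S\<in>insert (Suc n) ` Pow {1..n}. w S * (\<Prod>k\<in>S. (y(Suc n := v)) k))"
    unfolding multilinear_eval_def atLeastAtMost_1_Suc Pow_insert
    by (rule sum.union_disjoint) auto
  also have "\<dots> = (\<Sum>S\<in>Pow {1..n}. w S * (\<Prod>k\<in>S. y k)) +
    (\<Sum>S\<in>Pow {1..n}. w (insert (Suc n) S) * (v * (\<Prod>k\<in>S. y k)))"
    unfolding sum.reindex[OF inj] o_def using old new by simp
  finally show ?thesis
    by (simp add: multilinear_eval_def sum_distrib_left mult.left_commute)
qed

section \<open>Linearity and recombination of the two halves\<close>

lemma multilinear_eval_scale:
  "multilinear_eval n (\<lambda>S. c * w S) x = c * multilinear_eval n w x"
  by (simp add: multilinear_eval_def sum_distrib_left mult.assoc)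

lemma multilinear_eval_add:
  "multilinear_eval n (\<lambda>S. u S + w S) x = multilinear_eval n u x + multilinear_eval n w x"
  by (simp add: multilinear_eval_def sum.distrib distrib_right)

text \<open>Inverse of the splitting: the coefficients of \<open>a\<close> plus the last variable
  times \<open>b\<close>. Removing \<open>Suc n\<close> from \<open>S\<close> recovers the index of
  the coefficient in \<open>b\<close>.\<close>

definition join_coeffs :: "nat \<Rightarrow> (nat set \<Rightarrow> real) \<Rightarrow> (nat set \<Rightarrow> real) \<Rightarrow> nat set \<Rightarrow> real" where
  "join_coeffs n a b S = (if Suc n \<in> S then b (S - {Suc n}) else a S)"

lemma join_coeffs_simps:
  assumes "S \<subseteq> {1..n}"
  shows "join_coeffs n a b S = a S" "join_coeffs n a b (insert (Suc n) S) = b S"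
proof -
  have "Suc n \<notin> S" using assms by auto
  then show "join_coeffs n a b S = a S" "join_coeffs n a b (insert (Suc n) S) = b S"
    by (auto simp: join_coeffs_def)
qed

lemma multilinear_eval_join:
  "multilinear_eval (Suc n) (join_coeffs n a b) (y(Suc n := v)) =
    multilinear_eval n a y + v * multilinear_eval n b y"
proof -
  have "multilinear_eval n (join_coeffs n a b) y = multilinear_eval n a y"
    "multilinear_eval n (\<lambda>S. join_coeffs n a b (insert (Suc n) S)) y = multilinear_eval n b y"
    unfolding multilinear_eval_def by (auto intro!: sum.cong simp: join_coeffs_simps)
  then show ?thesis by (simp add: multilinear_eval_Suc)
qed

lemma subset_SucE:
  assumes "S \<subseteq> {1..Suc n}"
  obtains "S \<subseteq> {1..n}" | T where "T \<subseteq> {1..n}" "S = insert (Suc n) T"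
proof (cases "Suc n \<in> S")
  case True
  then show ?thesis
    using assms that(2)[of "S - {Suc n}"] unfolding atLeastAtMost_1_Suc by blast
next
  case False
  then show ?thesis
    using assms that(1) unfolding atLeastAtMost_1_Suc by blast
qed

text \<open>The parts \<open>a\<close> and \<open>b\<close> are the half sum and half difference of
  the values at last coordinate 1 and -1, so both inherit the bound \<open>G\<close>, and the
  induction loses no factor.\<close>

lemma coeff_bound:
  assumes "\<forall>x\<in>cube n. \<bar>multilinear_eval n w x\<bar> \<le> G" "S \<subseteq> {1..n}"
  shows "\<bar>w S\<bar> \<le> G"
  using assms
proof (induction n arbitrary: w S)
  case 0
  then show ?case by (simp add: cube_0 multilinear_eval_0)
next
  case (Suc n)
  let ?w' = "\<lambda>S. w (insert (Suc n) S)"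
  have b: "\<bar>multilinear_eval n w y\<bar> \<le> G" "\<bar>multilinear_eval n ?w' y\<bar> \<le> G" if "y \<in> cube n" for y
  proof -
    have "\<bar>multilinear_eval n w y + multilinear_eval n ?w' y\<bar> \<le> G"
      "\<bar>multilinear_eval n w y - multilinear_eval n ?w' y\<bar> \<le> G"
      using Suc.prems(1) that by (auto simp: ball_cube_Suc multilinear_eval_Suc)
    then show "\<bar>multilinear_eval n w y\<bar> \<le> G" "\<bar>multilinear_eval n ?w' y\<bar> \<le> G" by linarith+
  qed
  from Suc.prems(2) show ?case
    by (cases rule: subset_SucE) (use b Suc.IH[of w] Suc.IH[of ?w'] in auto)
qed

text \<open>Sums and differences of the values at last coordinate 1 and -1 are \<open>2 a\<close>
  and \<open>2 b\<close>. The induction hypothesis is therefore applied to doubled coefficients,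
  which costs one factor 2 per variable.\<close>

lemma coeff_Ints:
  assumes "\<forall>x\<in>cube n. multilinear_eval n w x \<in> \<int>" "S \<subseteq> {1..n}"
  shows "2 ^ n * w S \<in> \<int>"
  using assms
proof (induction n arbitrary: w S)
  case 0
  then show ?case by (simp add: cube_0 multilinear_eval_0)
next
  case (Suc n)
  let ?w' = "\<lambda>S. w (insert (Suc n) S)"
  have b: "multilinear_eval n (\<lambda>S. 2 * w S) y \<in> \<int>" "multilinear_eval n (\<lambda>S. 2 * ?w' S) y \<in> \<int>"
    if "y \<in> cube n" for y
  proof -
    have *: "multilinear_eval n w y + multilinear_eval n ?w' y \<in> \<int>"
      "multilinear_eval n w y - multilinear_eval n ?w' y \<in> \<int>"
      using Suc.prems(1) that by (auto simp: ball_cube_Suc multilinear_eval_Suc)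
    show "multilinear_eval n (\<lambda>S. 2 * w S) y \<in> \<int>" "multilinear_eval n (\<lambda>S. 2 * ?w' S) y \<in> \<int>"
      using Ints_add[OF *] Ints_diff[OF *] by (simp_all add: multilinear_eval_scale)
  qed
  from Suc.prems(2) show ?case
  proof (cases rule: subset_SucE)
    case 1
    then show ?thesis using Suc.IH[of "\<lambda>S. 2 * w S"] b(1) by (simp add: ac_simps)
  next
    case (2 T)
    then show ?thesis using Suc.IH[of "\<lambda>S. 2 * ?w' S"] b(2) by (simp add: ac_simps)
  qed
qed

section \<open>Sparse interpolation\<close>

definition slice :: "nat \<Rightarrow> (nat \<Rightarrow> real) set \<Rightarrow> real \<Rightarrow> (nat \<Rightarrow> real) set" where
  "slice n D v = {y \<in> cube n. y(Suc n := v) \<in> D}"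

text \<open>These are the standard monomials of the vanishing ideal of \<open>D\<close>, for the
  lexicographic order in which later variables are larger. A point in both slices imposes two
  conditions and determines both \<open>a\<close> and \<open>b\<close>; a point in just one slice
  imposes one condition, which \<open>a\<close> alone can meet. Hence \<open>a\<close> is
  interpolated on the union and \<open>b\<close> only on the intersection.\<close>

primrec monomials :: "nat \<Rightarrow> (nat \<Rightarrow> real) set \<Rightarrow> nat set set" where
  "monomials 0 D = (if D = {} then {} else {{}})"
| "monomials (Suc n) D = monomials n (slice n D 1 \<union> slice n D (-1)) \<union>
     insert (Suc n) ` monomials n (slice n D 1 \<inter> slice n D (-1))"

definition coeff_support :: "nat \<Rightarrow> (nat set \<Rightarrow> real) \<Rightarrow> nat set set" where
  "coeff_support n w = {S. S \<subseteq> {1..n} \<and> w S \<noteq> 0}"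

lemma slice_subset: "slice n D v \<subseteq> cube n"
  by (auto simp: slice_def)

lemma finite_slice: "finite (slice n D v)"
  by (rule finite_subset[OF slice_subset finite_cube])

lemma slice_mono: "D \<subseteq> E \<Longrightarrow> slice n D v \<subseteq> slice n E v"
  by (auto simp: slice_def)

lemma monomials_subset: "S \<in> monomials n D \<Longrightarrow> S \<subseteq> {1..n}"
proof (induction n arbitrary: D S)
  case (Suc n)
  then show ?case by (fastforce simp: atLeastAtMost_1_Suc)
qed (simp split: if_splits)

lemma finite_monomials: "finite (monomials n D)"
  by (induction n arbitrary: D) auto

lemma monomials_mono: "D \<subseteq> E \<Longrightarrow> monomials n D \<subseteq> monomials n E"
proof (induction n arbitrary: D E)
  case (Suc n)
  have "slice n D 1 \<union> slice n D (-1) \<subseteq> slice n E 1 \<union> slice n E (-1)"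
    "slice n D 1 \<inter> slice n D (-1) \<subseteq> slice n E 1 \<inter> slice n E (-1)"
    using slice_mono[OF Suc.prems] by blast+
  from this[THEN Suc.IH] show ?case by auto
qed auto

text \<open>\<open>D\<close> is a disjoint union of copies of its two slices, so this is
  inclusion-exclusion. It makes the recursion of \<open>monomials\<close> use no more than
  \<open>card D\<close> sets, and lets the exponents in \<open>interpolation_bound\<close> add up to
  \<open>card D\<close>.\<close>

lemma card_slices:
  assumes "D \<subseteq> cube (Suc n)"
  shows "card (slice n D 1 \<union> slice n D (-1)) + card (slice n D 1 \<inter> slice n D (-1)) = card D"
proof -
  let ?e = "\<lambda>v y. y(Suc n := v) :: nat \<Rightarrow> real"
  have inj: "inj_on (?e v) (slice n D v)" for v
    by (rule inj_onI) (metis (mono_tags) cube_upd_inj slice_subset subsetD)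
  have "D \<subseteq> ?e 1 ` slice n D 1 \<union> ?e (-1) ` slice n D (-1)"
  proof
    fix x assume x: "x \<in> D"
    then obtain y v where "y \<in> cube n" "v \<in> {-1, 1}" "x = y(Suc n := v)"
      using assms cube_SucE by blast
    with x show "x \<in> ?e 1 ` slice n D 1 \<union> ?e (-1) ` slice n D (-1)"
      by (auto simp: slice_def)
  qed
  then have "D = ?e 1 ` slice n D 1 \<union> ?e (-1) ` slice n D (-1)"
    by (auto simp: slice_def)
  moreover have "?e 1 y \<noteq> ?e (-1) z" for y z
    by (metis fun_upd_same one_neq_neg_one)
  then have "?e 1 ` slice n D 1 \<inter> ?e (-1) ` slice n D (-1) = {}"
    by blast
  ultimately have "card D = card (?e 1 ` slice n D 1) + card (?e (-1) ` slice n D (-1))"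
    by (metis (no_types, lifting) card_Un_disjoint finite_imageI finite_slice)
  also have "\<dots> = card (slice n D 1) + card (slice n D (-1))"
    by (simp only: card_image[OF inj])
  finally show ?thesis
    by (simp add: card_Un_Int[OF finite_slice finite_slice])
qed

lemma card_monomials: "D \<subseteq> cube n \<Longrightarrow> card (monomials n D) \<le> card D"
proof (induction n arbitrary: D)
  case 0
  then have "finite D" using finite_cube finite_subset by blast
  then show ?case by (cases "D = {}") (auto simp: Suc_le_eq card_gt_0_iff)
next
  case (Suc n)
  let ?U = "slice n D 1 \<union> slice n D (-1)" and ?I = "slice n D 1 \<inter> slice n D (-1)"
  have "card (monomials (Suc n) D) \<le> card (monomials n ?U) + card (monomials n ?I)"
    by (auto intro!: order_trans[OF card_Un_le] add_mono card_image_le finite_monomials)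
  also have "\<dots> \<le> card ?U + card ?I"
    using slice_subset by (intro add_mono Suc.IH) blast+
  finally show ?case using card_slices[OF Suc.prems] by simp
qed

text \<open>This makes the inductive hypotheses available for the two halves of any polynomial
  supported on \<open>monomials (Suc n) D\<close>.\<close>

lemma support_split:
  assumes "coeff_support (Suc n) w \<subseteq> monomials (Suc n) D"
  shows "coeff_support n w \<subseteq> monomials n (slice n D 1 \<union> slice n D (-1))" (is ?A)
    and "coeff_support n (\<lambda>S. w (insert (Suc n) S)) \<subseteq>
      monomials n (slice n D 1 \<inter> slice n D (-1))" (is ?B)
proof -
  let ?U = "slice n D 1 \<union> slice n D (-1)" and ?I = "slice n D 1 \<inter> slice n D (-1)"
  have out: "Suc n \<notin> S" if "S \<subseteq> {1..n}" for S using that by auto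
  show ?A
  proof
    fix S assume S: "S \<in> coeff_support n w"
    then have "S \<in> coeff_support (Suc n) w" and "Suc n \<notin> S"
      using out by (auto simp: coeff_support_def)
    with assms show "S \<in> monomials n ?U" by auto
  qed
  show ?B
  proof
    fix S assume S: "S \<in> coeff_support n (\<lambda>S. w (insert (Suc n) S))"
    then have "insert (Suc n) S \<in> coeff_support (Suc n) w" and S': "Suc n \<notin> S"
      using out by (auto simp: coeff_support_def)
    with assms have "insert (Suc n) S \<in> monomials (Suc n) D" by blast
    \<comment> \<open>Sets from the first part of the recursion never contain \<open>Suc n\<close>,
      so this one comes from the second part.\<close>
    moreover have "insert (Suc n) S \<notin> monomials n ?U"
      using monomials_subset out by blast
    ultimately obtain T where T: "T \<in> monomials n ?I" "insert (Suc n) S = insert (Suc n) T"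
      by auto
    with S' out[OF monomials_subset[OF T(1)]] have "S = T" by (metis insert_ident)
    with T show "S \<in> monomials n ?I" by simp
  qed
qed

lemma support_join:
  assumes "coeff_support n a \<subseteq> monomials n (slice n D 1 \<union> slice n D (-1))"
    and "coeff_support n b \<subseteq> monomials n (slice n D 1 \<inter> slice n D (-1))"
  shows "coeff_support (Suc n) (join_coeffs n a b) \<subseteq> monomials (Suc n) D"
proof
  fix S assume "S \<in> coeff_support (Suc n) (join_coeffs n a b)"
  then have S: "S \<subseteq> {1..Suc n}" "join_coeffs n a b S \<noteq> 0"
    by (auto simp: coeff_support_def)
  from S(1) show "S \<in> monomials (Suc n) D"
    by (cases rule: subset_SucE)
      (use S(2) assms in \<open>auto simp: join_coeffs_simps coeff_support_def\<close>)
qed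

text \<open>On the intersection of the slices the equations \<open>a + b = g0\<close> and
  \<open>a - b = g1\<close> force \<open>b = (g0 - g1) / 2\<close>. Once such a \<open>b\<close> is
  fixed on the whole cube, \<open>a\<close> is prescribed on the union by whichever equation
  applies.\<close>

lemma interpolation:
  assumes "D \<subseteq> cube n"
  obtains w where "coeff_support n w \<subseteq> monomials n D" "\<And>x. x \<in> D \<Longrightarrow> multilinear_eval n w x = g x"
  using assms
proof (induction n arbitrary: D g thesis)
  case 0
  show ?case
  proof (rule "0.prems"(1))
    \<comment> \<open>For empty \<open>D\<close> no monomial is allowed, so the constant must be
      0.\<close>
    show "coeff_support 0 (\<lambda>_. if D = {} then 0 else g (\<lambda>_. undefined)) \<subseteq> monomials 0 D"
      by (auto simp: coeff_support_def)
  qed (use "0.prems"(2) in \<open>auto simp: multilinear_eval_0 cube_0\<close>)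
next
  case (Suc n)
  define g0 g1 where "g0 y = g (y(Suc n := 1))" and "g1 y = g (y(Suc n := -1))" for y
  let ?U = "slice n D 1 \<union> slice n D (-1)" and ?I = "slice n D 1 \<inter> slice n D (-1)"
  have sub: "?U \<subseteq> cube n" "?I \<subseteq> cube n" using slice_subset by blast+
  obtain b where b: "coeff_support n b \<subseteq> monomials n ?I"
    "\<And>y. y \<in> ?I \<Longrightarrow> multilinear_eval n b y = (g0 y - g1 y) / 2"
    using Suc.IH[where D = ?I and g = "\<lambda>y. (g0 y - g1 y) / 2"] sub(2) by blast
  let ?b = "multilinear_eval n b"
  obtain a where a: "coeff_support n a \<subseteq> monomials n ?U"
    "\<And>y. y \<in> ?U \<Longrightarrow> multilinear_eval n a y = (if y \<in> slice n D 1 then g0 y - ?b y else g1 y + ?b y)"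
    using Suc.IH[where D = ?U and g = "\<lambda>y. if y \<in> slice n D 1 then g0 y - ?b y else g1 y + ?b y"] sub(1)
    by blast
  show ?case
  proof (rule Suc.prems(1)[OF support_join[OF a(1) b(1)]])
    fix x assume x: "x \<in> D"
    then obtain y v where y: "y \<in> cube n" "v \<in> {-1, 1}" "x = y(Suc n := v)"
      using Suc.prems(2) cube_SucE by blast
    with x have yv: "y \<in> slice n D v" by (simp add: slice_def)
    show "multilinear_eval (Suc n) (join_coeffs n a b) x = g x"
      unfolding y(3) multilinear_eval_join
    proof (cases "v = 1")
      case True
      then show "multilinear_eval n a y + v * ?b y = g (y(Suc n := v))"
        using yv a(2)[of y] by (simp add: g0_def)
    next
      case False
      then have v: "v = -1" using y by simp
      \<comment> \<open>If \<open>y\<close> lies in both slices, \<open>a\<close> was chosen by the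
        equation for \<open>v = 1\<close>; the value of \<open>b\<close> there makes the equation
        for \<open>v = -1\<close> hold too.\<close>
      show "multilinear_eval n a y + v * ?b y = g (y(Suc n := v))"
        using yv a(2)[of y] b(2)[of y] v by (auto simp: g0_def g1_def field_simps)
    qed
  qed
qed

text \<open>On the intersection \<open>b\<close> is a half difference of values, so \<open>b\<close>
  is at most \<open>(2 ^ card ?I - 1) * G\<close> on the cube. On the union \<open>a\<close> is then
  at most \<open>G\<close> plus this, that is \<open>2 ^ card ?I * G\<close>, which becomes the new
  bound in the induction hypothesis for \<open>a\<close>; hence \<open>G\<close> is generalised.
  Adding the two estimates telescopes.\<close>

lemma interpolation_bound:
  assumes "D \<subseteq> cube n" "coeff_support n w \<subseteq> monomials n D"
    and "\<And>x. x \<in> D \<Longrightarrow> \<bar>multilinear_eval n w x\<bar> \<le> G" "x \<in> cube n" "0 \<le> G"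
  shows "\<bar>multilinear_eval n w x\<bar> \<le> (2 ^ card D - 1) * G"
  using assms
proof (induction n arbitrary: D w G x)
  case 0
  show ?case
  proof (cases "D = {}")
    case True
    then show ?thesis
      using "0.prems" by (auto simp: multilinear_eval_0 coeff_support_def)
  next
    case False
    then have "D = {\<lambda>_. undefined}" using "0.prems"(1) by (auto simp: cube_0)
    then show ?thesis using "0.prems" by (auto simp: multilinear_eval_0)
  qed
next
  case (Suc n)
  let ?U = "slice n D 1 \<union> slice n D (-1)" and ?I = "slice n D 1 \<inter> slice n D (-1)"
  let ?a = "multilinear_eval n w" and ?b = "multilinear_eval n (\<lambda>S. w (insert (Suc n) S))"
  have sub: "?U \<subseteq> cube n" "?I \<subseteq> cube n" using slice_subset by blast+
  note supp = support_split[OF Suc.prems(2)]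
  have pos: "\<bar>?a y + ?b y\<bar> \<le> G" if "y \<in> slice n D 1" for y
    using Suc.prems(3)[of "y(Suc n := 1)", unfolded multilinear_eval_Suc] that
    unfolding slice_def mem_Collect_eq mult_1 by blast
  have neg: "\<bar>?a y - ?b y\<bar> \<le> G" if "y \<in> slice n D (-1)" for y
    using Suc.prems(3)[of "y(Suc n := -1)", unfolded multilinear_eval_Suc] that
    unfolding slice_def mem_Collect_eq mult_minus1 add_uminus_conv_diff by blast
  have b: "\<bar>?b y\<bar> \<le> (2 ^ card ?I - 1) * G" if "y \<in> cube n" for y
  proof (rule Suc.IH[OF sub(2) supp(2) _ that Suc.prems(5)])
    fix z assume "z \<in> ?I"
    then show "\<bar>?b z\<bar> \<le> G" using pos[of z] neg[of z] by auto
  qed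
  have a: "\<bar>?a y\<bar> \<le> (2 ^ card ?U - 1) * (2 ^ card ?I * G)" if "y \<in> cube n" for y
  proof (rule Suc.IH[OF sub(1) supp(1) _ that])
    fix z assume z: "z \<in> ?U"
    then have "\<bar>?a z\<bar> \<le> G + \<bar>?b z\<bar>" using pos[of z] neg[of z] by auto
    also have "\<dots> \<le> 2 ^ card ?I * G" using b[of z] z sub(1) by (auto simp: algebra_simps)
    finally show "\<bar>?a z\<bar> \<le> 2 ^ card ?I * G" .
  qed (use Suc.prems(5) in simp)
  obtain y v where y: "y \<in> cube n" "v \<in> {-1, 1}" "x = y(Suc n := v)"
    using Suc.prems(4) cube_SucE by blast
  have "\<bar>multilinear_eval (Suc n) w x\<bar> \<le> \<bar>?a y\<bar> + \<bar>?b y\<bar>"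
    using y(2) unfolding y(3) multilinear_eval_Suc by auto
  also have "\<dots> \<le> (2 ^ card ?U - 1) * (2 ^ card ?I * G) + (2 ^ card ?I - 1) * G"
    using a b y(1) by (intro add_mono) auto
  also have "\<dots> = (2 ^ (card ?U + card ?I) - 1) * G"
    by (simp add: algebra_simps power_add)
  finally show ?case using card_slices[OF Suc.prems(1)] by simp
qed

text \<open>With \<open>p = a + x b\<close>, applying the induction hypothesis to \<open>a\<close> and \<open>b\<close> would lose factors
  of 2. It is applied to \<open>2 b\<close> and to \<open>a + b\<close> instead, the latter being supported on the monomials
  of the union because \<open>monomials\<close> is monotone.\<close>

lemma interpolation_Ints:
  assumes "D \<subseteq> cube n" "coeff_support n w \<subseteq> monomials n D"
    and "\<And>x. x \<in> D \<Longrightarrow> multilinear_eval n w x \<in> \<int>" "x \<in> cube n"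
  shows "multilinear_eval n w x \<in> \<int>"
  using assms
proof (induction n arbitrary: D w x)
  case 0
  show ?case
  proof (cases "D = {}")
    case True
    then show ?thesis
      using "0.prems" by (auto simp: multilinear_eval_0 coeff_support_def)
  next
    case False
    then have "D = {\<lambda>_. undefined}" using "0.prems"(1) by (auto simp: cube_0)
    then show ?thesis using "0.prems" by (auto simp: multilinear_eval_0)
  qed
next
  case (Suc n)
  let ?U = "slice n D 1 \<union> slice n D (-1)" and ?I = "slice n D 1 \<inter> slice n D (-1)"
  let ?w' = "\<lambda>S. w (insert (Suc n) S)"
  let ?a = "multilinear_eval n w" and ?b = "multilinear_eval n ?w'"
  have sub: "?U \<subseteq> cube n" "?I \<subseteq> cube n" using slice_subset by blast+
  note supp = support_split[OF Suc.prems(2)]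
  have pos: "?a y + ?b y \<in> \<int>" if "y \<in> slice n D 1" for y
    using Suc.prems(3)[of "y(Suc n := 1)", unfolded multilinear_eval_Suc] that
    unfolding slice_def mem_Collect_eq mult_1 by blast
  have neg: "?a y - ?b y \<in> \<int>" if "y \<in> slice n D (-1)" for y
    using Suc.prems(3)[of "y(Suc n := -1)", unfolded multilinear_eval_Suc] that
    unfolding slice_def mem_Collect_eq mult_minus1 add_uminus_conv_diff by blast
  have b: "2 * ?b y \<in> \<int>" if "y \<in> cube n" for y
  proof -
    have "multilinear_eval n (\<lambda>S. 2 * ?w' S) y \<in> \<int>"
    proof (rule Suc.IH[OF sub(2) _ _ that])
      show "coeff_support n (\<lambda>S. 2 * ?w' S) \<subseteq> monomials n ?I"
        using supp(2) by (simp add: coeff_support_def)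
      fix z assume "z \<in> ?I"
      then show "multilinear_eval n (\<lambda>S. 2 * ?w' S) z \<in> \<int>"
        using Ints_diff[OF pos[of z] neg[of z]] by (simp add: multilinear_eval_scale)
    qed
    then show ?thesis by (simp add: multilinear_eval_scale)
  qed
  have ab: "?a y + ?b y \<in> \<int>" if "y \<in> cube n" for y
  proof -
    have "multilinear_eval n (\<lambda>S. w S + ?w' S) y \<in> \<int>"
    proof (rule Suc.IH[OF sub(1) _ _ that])
      have "?I \<subseteq> ?U" by blast
      then have "coeff_support n ?w' \<subseteq> monomials n ?U"
        using supp(2) monomials_mono by blast
      moreover have "coeff_support n (\<lambda>S. w S + ?w' S) \<subseteq> coeff_support n w \<union> coeff_support n ?w'"
        by (auto simp: coeff_support_def)
      ultimately show "coeff_support n (\<lambda>S. w S + ?w' S) \<subseteq> monomials n ?U"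
        using supp(1) by blast
      fix z assume z: "z \<in> ?U"
      have "?a z + ?b z \<in> \<int>"
      proof (cases "z \<in> slice n D 1")
        \<comment> \<open>Here \<open>z\<close> lies only in the slice for -1, and
          \<open>a + b = (a - b) + 2 b\<close>.\<close>
        case False
        with z have "?a z - ?b z \<in> \<int>" using neg by blast
        from Ints_add[OF this b[of z]] z sub(1) show ?thesis by (auto simp: algebra_simps)
      qed (rule pos)
      then show "multilinear_eval n (\<lambda>S. w S + ?w' S) z \<in> \<int>"
        by (simp add: multilinear_eval_add)
    qed
    then show ?thesis by (simp add: multilinear_eval_add)
  qed
  obtain y v where y: "y \<in> cube n" "v \<in> {-1, 1}" "x = y(Suc n := v)"
    using Suc.prems(4) cube_SucE by blast
  \<comment> \<open>At last coordinate -1 the value is \<open>a - b = (a + b) - 2 b\<close>.\<close>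
  show ?case
    using y(2) ab[OF y(1)] Ints_diff[OF ab[OF y(1)] b[OF y(1)]]
    unfolding y(3) multilinear_eval_Suc by auto
qed

section \<open>Threshold representations\<close>

text \<open>\<open>u\<close> is the sparse half, dominating on \<open>D\<close>; \<open>u'\<close>
  dominates elsewhere. Their places as \<open>a\<close> or \<open>b\<close> are assigned later,
  which is why a single sign pattern \<open>h\<close> serves both.\<close>

lemma sparse_dominated_pair:
  assumes D: "D \<subseteq> cube n" and h: "\<And>y. y \<in> cube n \<Longrightarrow> h y \<in> {-1, 1}"
  obtains u u' where
    "card (coeff_support n u) \<le> card D"
    "\<And>S. S \<subseteq> {1..n} \<Longrightarrow> u S \<in> \<int> \<and> \<bar>u S\<bar> \<le> 2 ^ n * 2 ^ card D"
    "\<And>S. S \<subseteq> {1..n} \<Longrightarrow> u' S \<in> \<int> \<and> \<bar>u' S\<bar> \<le> 2 ^ n * 2 ^ card D"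
    "\<And>y. y \<in> D \<Longrightarrow> 0 < h y * multilinear_eval n u y \<and> multilinear_eval n u' y = 0"
    "\<And>y. y \<in> cube n - D \<Longrightarrow> \<bar>multilinear_eval n u y\<bar> < h y * multilinear_eval n u' y"
proof -
  obtain b where b: "coeff_support n b \<subseteq> monomials n D"
    "\<And>y. y \<in> D \<Longrightarrow> multilinear_eval n b y = h y"
    using interpolation[OF D, of h] by blast
  \<comment> \<open>Interpolation on the full cube gives no control of the number of monomials. The
    value \<open>2 ^ card D\<close> is chosen to exceed \<open>b\<close> everywhere.\<close>
  obtain a where a: "\<And>y. y \<in> cube n \<Longrightarrow>
      multilinear_eval n a y = (if y \<in> D then 0 else h y * 2 ^ card D)"
    using interpolation[OF subset_refl, of n "\<lambda>y. if y \<in> D then 0 else h y * 2 ^ card D"] by blast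
  have b_lt: "\<bar>multilinear_eval n b y\<bar> < 2 ^ card D" if "y \<in> cube n" for y
  proof -
    have "\<bar>multilinear_eval n b y\<bar> \<le> (2 ^ card D - 1) * 1"
    proof (rule interpolation_bound[OF D b(1) _ that])
      fix z assume "z \<in> D"
      then show "\<bar>multilinear_eval n b z\<bar> \<le> 1" using b(2)[of z] h[of z] subsetD[OF D] by auto
    qed simp
    then show ?thesis by simp
  qed
  have b_int: "multilinear_eval n b y \<in> \<int>" if "y \<in> cube n" for y
  proof (rule interpolation_Ints[OF D b(1) _ that])
    fix z assume "z \<in> D"
    then show "multilinear_eval n b z \<in> \<int>" using b(2)[of z] h[of z] subsetD[OF D] by auto
  qed
  have a_int: "multilinear_eval n a y \<in> \<int>" and a_le: "\<bar>multilinear_eval n a y\<bar> \<le> 2 ^ card D"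
    if "y \<in> cube n" for y
    using a[OF that] h[OF that] by auto
  \<comment> \<open>Integer values on the cube leave denominators dividing \<open>2 ^ n\<close> in
    the coefficients; this factor clears them.\<close>
  let ?u = "\<lambda>S. 2 ^ n * b S" and ?u' = "\<lambda>S. 2 ^ n * a S"
  show thesis
  proof
    have "coeff_support n ?u = coeff_support n b" by (simp add: coeff_support_def)
    then have "card (coeff_support n ?u) \<le> card (monomials n D)"
      using b(1) card_mono[OF finite_monomials] by simp
    with card_monomials[OF D] show "card (coeff_support n ?u) \<le> card D" by simp
  next
    fix S :: "nat set" assume S: "S \<subseteq> {1..n}"
    have "\<bar>b S\<bar> \<le> 2 ^ card D" "\<bar>a S\<bar> \<le> 2 ^ card D"
      by (rule coeff_bound[OF _ S]; use b_lt a_le in \<open>auto intro: less_imp_le\<close>)+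
    moreover have "?u S \<in> \<int>" "?u' S \<in> \<int>"
      by (rule coeff_Ints[OF _ S]; use b_int a_int in blast)+
    ultimately show "?u S \<in> \<int> \<and> \<bar>?u S\<bar> \<le> 2 ^ n * 2 ^ card D"
      "?u' S \<in> \<int> \<and> \<bar>?u' S\<bar> \<le> 2 ^ n * 2 ^ card D"
      by (simp_all add: abs_mult)
  next
    fix y assume y: "y \<in> D"
    then have "y \<in> cube n" using D by blast
    with y show "0 < h y * multilinear_eval n ?u y \<and> multilinear_eval n ?u' y = 0"
      using h[of y] a[of y] b(2)[of y] by (auto simp: multilinear_eval_scale)
  next
    fix y assume y: "y \<in> cube n - D"
    then show "\<bar>multilinear_eval n ?u y\<bar> < h y * multilinear_eval n ?u' y"
      using h[of y] a[of y] b_lt[of y] by (auto simp: multilinear_eval_scale abs_mult)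
  qed
qed

lemma card_support_join:
  "card (coeff_support (Suc n) (join_coeffs n a b)) \<le> card (coeff_support n a) + card (coeff_support n b)"
proof -
  have fin: "finite (coeff_support n w)" for w
    by (rule finite_subset[of _ "Pow {1..n}"]) (auto simp: coeff_support_def)
  have "coeff_support (Suc n) (join_coeffs n a b) \<subseteq>
      coeff_support n a \<union> insert (Suc n) ` coeff_support n b"
  proof
    fix S assume "S \<in> coeff_support (Suc n) (join_coeffs n a b)"
    then have S: "S \<subseteq> {1..Suc n}" "join_coeffs n a b S \<noteq> 0"
      by (auto simp: coeff_support_def)
    from S(1) show "S \<in> coeff_support n a \<union> insert (Suc n) ` coeff_support n b"
      by (cases rule: subset_SucE) (use S(2) in \<open>auto simp: join_coeffs_simps coeff_support_def\<close>)
  qed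
  then have "card (coeff_support (Suc n) (join_coeffs n a b)) \<le>
      card (coeff_support n a \<union> insert (Suc n) ` coeff_support n b)"
    using fin by (intro card_mono) auto
  also have "\<dots> \<le> card (coeff_support n a) + card (coeff_support n b)"
    using fin by (intro order_trans[OF card_Un_le] add_mono card_image_le) auto
  finally show ?thesis .
qed

lemma card_support_le: "card (coeff_support n w) \<le> 2 ^ n"
proof -
  have "card (coeff_support n w) \<le> card (Pow {1..n})"
    by (rule card_mono) (auto simp: coeff_support_def)
  then show ?thesis by (simp add: card_Pow)
qed

section \<open>Points at which the last coordinate changes the function\<close>

definition flips :: "nat \<Rightarrow> ((nat \<Rightarrow> real) \<Rightarrow> real) \<Rightarrow> (nat \<Rightarrow> real) set" where
  "flips n f = {y \<in> cube n. f (y(Suc n := 1)) \<noteq> f (y(Suc n := -1))}"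

lemma card_flips_le:
  assumes "boolean_function (Suc n) f" "s \<in> {-1, 1}"
  shows "card (flips n f) \<le> card {x \<in> cube (Suc n). f x = s}"
proof (rule card_inj_on_le)
  \<comment> \<open>The last coordinate is 1 if \<open>f\<close> equals \<open>s\<close> there, and
    -1 otherwise; at a flip point the value at -1 is then \<open>s\<close>.\<close>
  let ?e = "\<lambda>y. y(Suc n := s * f (y(Suc n := 1)))"
  show "inj_on ?e (flips n f)"
  proof (rule inj_onI)
    fix y z assume "y \<in> flips n f" "z \<in> flips n f" "?e y = ?e z"
    then show "y = z" by (intro cube_upd_inj[of y n z]) (auto simp: flips_def)
  qed
  show "?e ` flips n f \<subseteq> {x \<in> cube (Suc n). f x = s}"
  proof clarify
    fix y assume "y \<in> flips n f"
    then have y: "y \<in> cube n" "f (y(Suc n := 1)) \<noteq> f (y(Suc n := -1))"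
      by (auto simp: flips_def)
    then have "f (y(Suc n := 1)) \<in> {-1, 1}" "f (y(Suc n := -1)) \<in> {-1, 1}"
      using assms(1) cube_upd[OF y(1)] by (auto simp: boolean_function_def)
    then show "?e y \<in> cube (Suc n) \<and> f (?e y) = s"
      using y assms(2) by (auto intro: cube_upd)
  qed
  show "finite {x \<in> cube (Suc n). f x = s}" using finite_cube by simp
qed

lemma two_power_le_powr:
  assumes "k \<le> m" "1 \<le> m"
  shows "2 ^ n * 2 ^ k \<le> 2 powr (real (Suc n) + 0.5 * real m * log 2 (real m) - real m
    + 1.5 * log 2 (real m) + 2)"
proof -
  \<comment> \<open>Twice the inequality between the exponents, with \<open>k\<close> replaced by
    its upper bound \<open>m\<close> and \<open>n\<close> cancelled. For \<open>m\<close> at least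
    16 the logarithm is at least 4, and the remaining cases are finitely many.\<close>
  have "4 * real m \<le> 6 + (real m + 3) * log 2 (real m)"
  proof (cases "16 \<le> m")
    case True
    then have "log 2 16 \<le> log 2 (real m)" by simp
    moreover have "log 2 16 = (4 :: real)" using log_pow_cancel[of "2 :: real" 4] by simp
    ultimately have "(real m + 3) * 4 \<le> (real m + 3) * log 2 (real m)"
      by (intro mult_left_mono) auto
    then show ?thesis by simp
  next
    case False
    then have "m \<in> set [1..<16]"
      using assms(2) by simp
    then have "m \<in> {1, 2, 3, 4, 5, 6, 7, 8, 9, 10, 11, 12, 13, 14, 15}"
      by (simp add: upt_conv_Cons numeral_eq_Suc del: set_upt)
    \<comment> \<open>The exponential form of the claim, checked numerically for each of the fifteen
      values.\<close>
    then have "(2 :: nat) ^ (4 * m) \<le> 2 ^ 6 * m ^ (m + 3)"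
      by (elim insertE emptyE) simp_all
    then have "real (2 ^ (4 * m)) \<le> real (2 ^ 6 * m ^ (m + 3))"
      by (rule of_nat_mono)
    then have "real (4 * m) \<le> log 2 (2 ^ 6 * real m ^ (m + 3))"
      by (intro le_log_of_power) simp_all
    also have "\<dots> = log 2 (2 ^ 6) + log 2 (real m ^ (m + 3))"
      using assms(2) by (intro log_mult_pos) auto
    also have "log 2 (2 ^ 6) = (6 :: real)"
      using log_pow_cancel[of "2 :: real" 6] by simp
    finally show ?thesis
      using assms(2) by (simp add: log_nat_power add.commute)
  qed
  then have "real n + real k \<le> real (Suc n) + 0.5 * real m * log 2 (real m) - real m
      + 1.5 * log 2 (real m) + 2"
    using assms(1) by (simp add: algebra_simps)
  then have "2 powr (real n + real k) \<le> 2 powr (real (Suc n) + 0.5 * real m * log 2 (real m)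
      - real m + 1.5 * log 2 (real m) + 2)"
    by simp
  then show ?thesis by (simp add: powr_add powr_realpow)
qed

lemma ptf_exists:
  assumes f: "boolean_function (Suc n) f" and D: "D = flips n f \<or> D = cube n - flips n f"
  obtains w where "ptf_represents (Suc n) w f"
    "\<And>S. S \<subseteq> {1..Suc n} \<Longrightarrow> w S \<in> \<int> \<and> \<bar>w S\<bar> \<le> 2 ^ n * 2 ^ card D"
    "ptf_length (Suc n) w \<le> 2 ^ n + card D"
proof -
  \<comment> \<open>At a flip point the sign of \<open>a + v b\<close> must be that of
    \<open>v h\<close>, so \<open>b\<close> needs sign \<open>h\<close>; elsewhere both signs are
    \<open>h\<close>, so \<open>a\<close> needs sign \<open>h\<close>.\<close>
  define h where "h y = f (y(Suc n := 1))" for y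
  have h: "h y \<in> {-1, 1}" and f_neg: "f (y(Suc n := -1)) = (if y \<in> flips n f then - h y else h y)"
    if "y \<in> cube n" for y
  proof -
    have "f (y(Suc n := 1)) \<in> {-1, 1}" "f (y(Suc n := -1)) \<in> {-1, 1}"
      using f cube_upd[OF that] by (auto simp: boolean_function_def)
    then show "h y \<in> {-1, 1}" "f (y(Suc n := -1)) = (if y \<in> flips n f then - h y else h y)"
      using that by (auto simp: h_def flips_def)
  qed
  have "D \<subseteq> cube n" using D by (auto simp: flips_def)
  then obtain u u' where
    card: "card (coeff_support n u) \<le> card D" and
    u: "\<And>S. S \<subseteq> {1..n} \<Longrightarrow> u S \<in> \<int> \<and> \<bar>u S\<bar> \<le> 2 ^ n * 2 ^ card D" and
    u': "\<And>S. S \<subseteq> {1..n} \<Longrightarrow> u' S \<in> \<int> \<and> \<bar>u' S\<bar> \<le> 2 ^ n * 2 ^ card D" and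
    on: "\<And>y. y \<in> D \<Longrightarrow> 0 < h y * multilinear_eval n u y \<and> multilinear_eval n u' y = 0" and
    off: "\<And>y. y \<in> cube n - D \<Longrightarrow> \<bar>multilinear_eval n u y\<bar> < h y * multilinear_eval n u' y"
    by (rule sparse_dominated_pair[of D n h]) (erule h, rule that)
  \<comment> \<open>The half multiplied by the last variable must dominate on the flip points, so it
    is the sparse \<open>u\<close> exactly when \<open>D\<close> is the set of flip points.\<close>
  define a where "a = (if D = flips n f then u' else u)"
  define b where "b = (if D = flips n f then u else u')"
  have ab: "(a = u' \<and> b = u) \<or> (a = u \<and> b = u')"
    by (auto simp: a_def b_def)
  let ?a = "multilinear_eval n a" and ?b = "multilinear_eval n b"
  have dom: "if y \<in> flips n f then \<bar>?a y\<bar> < h y * ?b y else \<bar>?b y\<bar> < h y * ?a y"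
    if "y \<in> cube n" for y
    using that D on[of y] off[of y] by (auto simp: a_def b_def split: if_splits)
  show thesis
  proof
    show "ptf_represents (Suc n) (join_coeffs n a b) f"
      unfolding ptf_represents_def ball_cube_Suc multilinear_eval_join
    proof (intro ballI conjI)
      fix y assume y: "y \<in> cube n"
      show "f (y(Suc n := 1)) = sgn (?a y + 1 * ?b y)"
        using dom[OF y] h[OF y] by (auto simp: h_def[symmetric] sgn_if split: if_splits)
      show "f (y(Suc n := -1)) = sgn (?a y + -1 * ?b y)"
        using dom[OF y] h[OF y] unfolding f_neg[OF y] by (auto simp: sgn_if split: if_splits)
    qed
  next
    fix S assume "S \<subseteq> {1..Suc n}"
    then show "join_coeffs n a b S \<in> \<int> \<and> \<bar>join_coeffs n a b S\<bar> \<le> 2 ^ n * 2 ^ card D"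
      by (cases rule: subset_SucE) (use u u' ab in \<open>auto simp: join_coeffs_simps\<close>)
  next
    have "ptf_length (Suc n) (join_coeffs n a b) = card (coeff_support (Suc n) (join_coeffs n a b))"
      by (simp add: ptf_length_def coeff_support_def)
    also have "\<dots> \<le> card (coeff_support n a) + card (coeff_support n b)"
      by (rule card_support_join)
    also have "\<dots> \<le> 2 ^ n + card D"
      using ab card card_support_le[of n u'] by auto
    finally show "ptf_length (Suc n) (join_coeffs n a b) \<le> 2 ^ n + card D" .
  qed
qed

theorem theorem6:
  fixes n m :: nat and f :: "(nat \<Rightarrow> real) \<Rightarrow> real"
  assumes "n \<ge> 1"
    and "boolean_function n f"
    and "sparse n m f"
    and "1 \<le> m" and "m \<le> 2 ^ (n - 1)"
  shows "\<exists>w :: nat set \<Rightarrow> real.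
    ptf_represents n w f \<and>
    (\<forall>S. S \<subseteq> {1..n} \<longrightarrow> w S \<in> \<int>) \<and>
    real (ptf_length n w) \<le> 2 ^ (n - 1) + min (real m) (2 powr (real n - 2)) \<and>
    (\<forall>S. S \<subseteq> {1..n} \<longrightarrow>
      \<bar>w S\<bar> \<le> 2 powr (real n + 0.5 * real m * log 2 (real m) - real m + 1.5 * log 2 (real m) + 2))"
proof -
  obtain N where n: "n = Suc N" using assms(1) by (cases n) auto
  note f = assms(2)[unfolded n]
  \<comment> \<open>Since \<open>m\<close> is a minimum over the two values of \<open>f\<close>, the
    estimate is needed for both signs.\<close>
  have flips_le: "card (flips N f) \<le> m"
    using card_flips_le[OF f, of 1] card_flips_le[OF f, of "-1"] assms(3)
    by (simp add: sparse_def n)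
  have sub: "flips N f \<subseteq> cube N" by (auto simp: flips_def)
  have fin: "finite (flips N f)" using finite_subset[OF sub finite_cube] .
  have sum: "card (flips N f) + card (cube N - flips N f) = 2 ^ N"
    using card_Diff_subset[OF fin sub] card_mono[OF finite_cube sub] by (simp add: card_cube)
  define D where "D = (if card (flips N f) \<le> card (cube N - flips N f)
    then flips N f else cube N - flips N f)"
  have D: "D = flips N f \<or> D = cube N - flips N f" "card D \<le> m" "2 * card D \<le> 2 ^ N"
    using flips_le sum by (auto simp: D_def)
  from f D(1) obtain w where w: "ptf_represents n w f"
    "\<And>S. S \<subseteq> {1..n} \<Longrightarrow> w S \<in> \<int> \<and> \<bar>w S\<bar> \<le> 2 ^ N * 2 ^ card D"
    "ptf_length n w \<le> 2 ^ N + card D"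
    unfolding n by (rule ptf_exists) blast
  \<comment> \<open>The doubled form also covers dimension 1, where the bound
    \<open>2 powr (real n - 2)\<close> is 1/2 and \<open>D\<close> must be empty.\<close>
  have "real (2 * card D) \<le> real (2 ^ N)"
    using D(3) by (rule of_nat_mono)
  moreover have "2 powr (real n - 2) = 2 ^ N / 2"
    by (simp add: n powr_diff powr_realpow powr_add)
  ultimately have "real (card D) \<le> min (real m) (2 powr (real n - 2))"
    using D(2) by (intro min.boundedI) auto
  moreover have "real (ptf_length n w) \<le> real (2 ^ N + card D)"
    using w(3) by (rule of_nat_mono)
  ultimately have "real (ptf_length n w) \<le> 2 ^ (n - 1) + min (real m) (2 powr (real n - 2))"
    unfolding n by (simp del: min_less_iff_conj min.bounded_iff)
  moreover have "\<bar>w S\<bar> \<le> 2 powr (real n + 0.5 * real m * log 2 (real m) - real m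
      + 1.5 * log 2 (real m) + 2)" if "S \<subseteq> {1..n}" for S
    using w(2)[OF that] two_power_le_powr[OF D(2) assms(4), of N] unfolding n by linarith
  ultimately show ?thesis using w(1,2) by blast
qed

end
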